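(* Let $T$ be a data set over an $n\times n$ strategy space. If $T$ is laminar and satisfies the uniqueness property, then $T$ can be rationalized by a zero-sum game, i.e. there is a real $n\times n$ matrix $A$ such that the game $(A,-A)$ rationalizes $T$.
   Context: Write $[n]=\{1,\dots,n\}$. An $n\times n$ bimatrix game is a pair $(A,B)$ of real $n\times n$ matrices: $A$ is the payoff matrix of the row player and $B$ that of the column player. The game is zero-sum if $A+B=0$. A subgame is a pair $(I,J)$ with $I,J\subseteq[n]$. A data set $T$ (over an $n\times n$ strategy space) is a set of triples $((i,j),I,J)$, called observations, where $(I,J)$ is a subgame, $i\in I$ and $j\in J$; $(i,j)$ is the observed choice of the observation. A subgame $(I,J)$ is said to be in $T$ if it occurs in some observation of $T$. A profile $(i,j)\in I\times J$ is a strict (pure) Nash equilibrium of the subgame $(I,J)$ of $(A,B)$ if $A_{ij}>A_{i'j}$ for all $i'\in I\setminus\{i\}$ and $B_{ij}>B_{ij'}$ for all $j'\in J\setminus\{j\}$. The game $(A,B)$ rationalizes $T$ if for every $((i,j),I,J)\in T$ the profile $(i,j)$ is a strict Nash equilibrium of the subgame $(I,J)$. $T$ is rationalizable if some bimatrix game rationalizes it. Two subgames $(I,J)$ and $(I',J')$ cross if $(I\times J)\cap(I'\times J')\neq\emptyset$, $I\times J\not\subseteq I'\times J'$ and $I'\times J'\not\subseteq I\times J$. A data set is laminar if no two subgames in it cross. A rationalizable data set $T$ satisfies the uniqueness property if for every subgame $(I,J)$ in $T$ there is exactly one observed choice $(i,j)$ (i.e. exactly one $(i,j)$ with $((i,j),I,J)\in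 T$), and moreover, whenever $((i,j),I,J),((i',j'),I',J')\in T$ with $I'\times J'\subseteq I\times J$ and $(i,j)\in I'\times J'$, then $(i',j')=(i,j)$. *)

theory Defs
  imports "HOL-Analysis.Analysis"
begin

text \<open>
  The strategy set $[n]$ is the universe of a finite index type \<open>'n\<close> with
  \<open>CARD('n) = n\<close>, so subgames are arbitrary pairs of sets over \<open>'n\<close>.
  The first index of a matrix is the row, i.e. \<open>A $ i $ j\<close> is $A_{ij}$.
\<close>

type_synonym 'n subgame = "'n set \<times> 'n set"
type_synonym 'n observation = "('n \<times> 'n) \<times> 'n subgame"

definition data_set :: "'n::finite observation set \<Rightarrow> bool" where
  "data_set T \<longleftrightarrow> (\<forall>i j I J. ((i, j), I, J) \<in> T \<longrightarrow> i \<in> I \<and> j \<in> J)"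

definition subgames_of :: "'n::finite observation set \<Rightarrow> 'n subgame set" where
  "subgames_of T = {(I, J). \<exists>p. (p, I, J) \<in> T}"

definition strict_nash ::
    "real^'n^'n \<Rightarrow> real^'n^'n \<Rightarrow> 'n::finite set \<Rightarrow> 'n set \<Rightarrow> 'n \<Rightarrow> 'n \<Rightarrow> bool" where
  "strict_nash A B I J i j \<longleftrightarrow>
     i \<in> I \<and> j \<in> J \<and>
     (\<forall>i'\<in>I - {i}. A $ i $ j > A $ i' $ j) \<and>
     (\<forall>j'\<in>J - {j}. B $ i $ j > B $ i $ j')"

definition rationalizes ::
    "real^'n^'n \<Rightarrow> real^'n^'n \<Rightarrow> 'n::finite observation set \<Rightarrow> bool" where
  "rationalizes A B T \<longleftrightarrow> (\<forall>i j I J. ((i, j), I, J) \<in> T \<longrightarrow> strict_nash A B I J i j)"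

definition rationalizable :: "'n::finite observation set \<Rightarrow> bool" where
  "rationalizable T \<longleftrightarrow> (\<exists>A B. rationalizes A B T)"

definition crossing :: "'n::finite subgame \<Rightarrow> 'n subgame \<Rightarrow> bool" where
  "crossing = (\<lambda>(I, J) (I', J').
     (I \<times> J) \<inter> (I' \<times> J') \<noteq> {} \<and> \<not> I \<times> J \<subseteq> I' \<times> J' \<and> \<not> I' \<times> J' \<subseteq> I \<times> J)"

definition laminar :: "'n::finite observation set \<Rightarrow> bool" where
  "laminar T \<longleftrightarrow> (\<forall>S\<in>subgames_of T. \<forall>S'\<in>subgames_of T. \<not> crossing S S')"

text \<open>The uniqueness property is a notion for rationalizable data sets only; hence the
  first conjunct.\<close>

definition uniqueness_property :: "'n::finite observation set \<Rightarrow> bool" where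
  "uniqueness_property T \<longleftrightarrow>
     rationalizable T \<and>
     (\<forall>(I, J)\<in>subgames_of T. \<exists>!p. (p, I, J) \<in> T) \<and>
     (\<forall>i j I J i' j' I' J'.
        ((i, j), I, J) \<in> T \<longrightarrow> ((i', j'), I', J') \<in> T \<longrightarrow>
        I' \<times> J' \<subseteq> I \<times> J \<longrightarrow> (i, j) \<in> I' \<times> J' \<longrightarrow> (i', j') = (i, j))"

end

theory Submission
  imports Defs
begin

text \<open>
  A zero-sum game rationalizes \<open>T\<close> iff its single payoff matrix satisfies strict inequalities
  between pairs of cells, so such a game exists as soon as the digraph of these inequalities is
  acyclic. All inequalities of an observation involve its observed choice \<open>c\<close>. In a set \<open>U\<close> of
  observations choose one with a maximal rectangle; by laminarity and uniqueness every rectangle of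
  \<open>U\<close> containing its choice \<open>c = (i, j)\<close> has the same choice. Hence a cycle through \<open>c\<close> leaves it
  for a cell \<open>(i', j)\<close> of the column of \<open>c\<close> and comes back from a cell \<open>(i, j')\<close> of its row, using
  in between only rectangles that avoid \<open>c\<close>. By laminarity one of these contains both end cells,
  but then, being a rectangle, it contains \<open>c\<close> as well. A cycle avoiding \<open>c\<close> is excluded by
  induction on \<open>U\<close>.
\<close>

text \<open>An edge \<open>(p, q)\<close> demands a larger row payoff at \<open>p\<close> than at
  \<open>q\<close>. The column player's inequalities point towards the observed cell because the
  payoff matrix B is the negative of A.\<close>

definition forced :: "'n::finite observation set \<Rightarrow> ('n \<times> 'n) rel" where
  "forced U = {(p, q). \<exists>i j I J. ((i, j), I, J) \<in> U \<and>
     (p = (i, j) \<and> (\<exists>i'\<in>I - {i}. q = (i', j)) \<or> q = (i, j) \<and> (\<exists>j'\<in>J - {j}. p = (i, j')))}"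

lemma forced_cells:
  assumes "data_set U" "(p, q) \<in> forced U"
  obtains c I J where "(c, I, J) \<in> U" "p \<in> I \<times> J" "q \<in> I \<times> J"
  using assms unfolding forced_def data_set_def by blast

lemma data_set_subset: "data_set T \<Longrightarrow> U \<subseteq> T \<Longrightarrow> data_set U"
  unfolding data_set_def by blast

lemma laminar_nested:
  assumes "laminar T" "(c, I, J) \<in> T" "(c', I', J') \<in> T" "p \<in> I \<times> J" "p \<in> I' \<times> J'"
  shows "I \<times> J \<subseteq> I' \<times> J' \<or> I' \<times> J' \<subseteq> I \<times> J"
proof -
  have "(I, J) \<in> subgames_of T" "(I', J') \<in> subgames_of T"
    using assms(2,3) unfolding subgames_of_def by blast+
  then have "\<not> crossing (I, J) (I', J')"
    using assms(1) unfolding laminar_def by blast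
  then show ?thesis
    using assms(4,5) unfolding crossing_def by blast
qed

text \<open>Rectangles carrying consecutive edges share the middle cell, so laminarity nests them,
  and the larger one holds both outer cells. Iterating, one rectangle absorbs the whole
  path.\<close>

lemma trancl_forced_common_subgame:
  assumes "data_set T" "laminar T" "U \<subseteq> T" "(p, q) \<in> (forced U)\<^sup>+"
  shows "\<exists>c I J. (c, I, J) \<in> U \<and> p \<in> I \<times> J \<and> q \<in> I \<times> J"
  using assms(4)
proof (induction rule: trancl_induct)
  case (base q)
  then show ?case
    using forced_cells[OF data_set_subset[OF assms(1,3)]] by metis
next
  case (step q r)
  obtain c I J where S: "(c, I, J) \<in> U" "p \<in> I \<times> J" "q \<in> I \<times> J"
    using step.IH by blast
  obtain c' I' J' where S': "(c', I', J') \<in> U" "q \<in> I' \<times> J'" "r \<in> I' \<times> J'"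
    using forced_cells[OF data_set_subset[OF assms(1,3)] step.hyps(2)] by metis
  have "I \<times> J \<subseteq> I' \<times> J' \<or> I' \<times> J' \<subseteq> I \<times> J"
    using laminar_nested[OF assms(2)] S S' assms(3) by blast
  then show ?case
    using S S' by blast
qed

lemma acyclic_add_vertex:
  assumes "acyclic F"
    and F: "\<And>p q. (p, q) \<in> F \<Longrightarrow> p \<noteq> c \<and> q \<noteq> c"
    and c: "c \<notin> X" "c \<notin> Y"
    and no_path: "\<And>x y. x \<in> X \<Longrightarrow> y \<in> Y \<Longrightarrow> (y, x) \<notin> F\<^sup>*"
  shows "acyclic (F \<union> X \<times> {c} \<union> {c} \<times> Y)" (is "acyclic ?R")
proof -
  define D where "D = F\<^sup>* `` Y"
  \<comment> \<open>Three layers: what \<open>Y\<close> reaches, then \<open>c\<close>, then the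
    rest, which contains \<open>X\<close> by \<open>no_path\<close>. No edge climbs and every edge
    at \<open>c\<close> drops strictly, so a cycle would have to lie in \<open>F\<close>.\<close>
  define level :: "'a \<Rightarrow> nat" where
    "level p = (if p \<in> D then 0 else if p = c then 1 else 2)" for p
  have "c \<notin> D"
    unfolding D_def using c F by (blast elim: rtranclE)
  have D_closed: "q \<in> D" if "p \<in> D" "(p, q) \<in> F" for p q
    using that unfolding D_def by (auto intro: rtrancl_into_rtrancl)
  have edge: "level q < level p \<or> level q = level p \<and> (p, q) \<in> F" if "(p, q) \<in> ?R" for p q
    using that
  proof (elim UnE)
    assume "(p, q) \<in> F"
    then show ?thesis
      using D_closed[of p q] F[of p q] by (auto simp: level_def)
  next
    assume "(p, q) \<in> X \<times> {c}"
    moreover from this have "p \<notin> D" "p \<noteq> c"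
      using c no_path unfolding D_def by auto
    ultimately show ?thesis
      using \<open>c \<notin> D\<close> by (auto simp: level_def)
  next
    assume "(p, q) \<in> {c} \<times> Y"
    then show ?thesis
      using \<open>c \<notin> D\<close> by (auto simp: level_def D_def)
  qed
  have "level q < level p \<or> level q = level p \<and> (p, q) \<in> F\<^sup>+" if "(p, q) \<in> ?R\<^sup>+" for p q
    using that
  proof (induction rule: trancl_induct)
    case (base q)
    then show ?case using edge by blast
  next
    case (step q r)
    then show ?case using edge[OF step.hyps(2)] by (auto intro: trancl_into_trancl)
  qed
  then show ?thesis
    using \<open>acyclic F\<close> unfolding acyclic_def by blast
qed

lemma obtain_maximal_subgame:
  fixes U :: "'n::finite observation set"
  assumes "U \<noteq> {}"
  obtains c I J where "(c, I, J) \<in> U"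
    "\<And>c' I' J'. (c', I', J') \<in> U \<Longrightarrow> I \<times> J \<subseteq> I' \<times> J' \<Longrightarrow> I' \<times> J' = I \<times> J"
proof -
  define rects where "rects = (\<lambda>(c, I, J). I \<times> J) ` U"
  have "finite rects" "rects \<noteq> {}"
    using assms by (simp_all add: rects_def)
  then obtain R where "R \<in> rects" "\<And>R'. R' \<in> rects \<Longrightarrow> R \<subseteq> R' \<Longrightarrow> R = R'"
    using finite_has_maximal by metis
  moreover from this obtain c I J where "(c, I, J) \<in> U" "R = I \<times> J"
    unfolding rects_def by auto
  moreover have "I' \<times> J' \<in> rects" if "(c', I', J') \<in> U" for c' I' J'
    using that unfolding rects_def by force
  ultimately show thesis
    using that by metis
qed

lemma acyclic_forced:
  fixes T :: "'n::finite observation set"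
  assumes T: "data_set T" "laminar T"
    and unique: "\<And>c I J c' I' J'. (c, I, J) \<in> T \<Longrightarrow> (c', I', J') \<in> T \<Longrightarrow>
      I' \<times> J' \<subseteq> I \<times> J \<Longrightarrow> c \<in> I' \<times> J' \<Longrightarrow> c' = c"
  shows "U \<subseteq> T \<Longrightarrow> acyclic (forced U)"
proof (induction U rule: finite_psubset_induct[OF finite])
  case (1 U)
  show ?case
  proof (cases "U = {}")
    case True
    then show ?thesis by (simp add: forced_def acyclic_def)
  next
    case False
    then obtain c I J where S: "(c, I, J) \<in> U"
      and maximal: "\<And>c' I' J'. (c', I', J') \<in> U \<Longrightarrow> I \<times> J \<subseteq> I' \<times> J' \<Longrightarrow> I' \<times> J' = I \<times> J"
      by (rule obtain_maximal_subgame) blast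
    obtain i j where c: "c = (i, j)" by fastforce
    have cS: "c \<in> I \<times> J"
      using S T(1) "1.prems" unfolding data_set_def c by blast
    have center: "c' = c" if "(c', I', J') \<in> U" "c \<in> I' \<times> J'" for c' I' J'
    proof -
      have in_T: "(c, I, J) \<in> T" "(c', I', J') \<in> T"
        using that(1) S "1.prems" by auto
      \<comment> \<open>The rectangles are nested since they share \<open>c\<close>; maximality
        turns the wrong inclusion into an equality.\<close>
      have "I' \<times> J' \<subseteq> I \<times> J"
        using laminar_nested[OF T(2) in_T cS that(2)] maximal[OF that(1)] by auto
      then show ?thesis
        using unique[OF in_T] that(2) by simp
    qed
    define V where "V = {(c', I', J') \<in> U. c \<notin> I' \<times> J'}"
    \<comment> \<open>\<open>X\<close> and \<open>Y\<close> are all other cells of the row and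
      column of \<open>c\<close>. This may add edges that no observation forces, which is harmless:
      acyclicity passes to subrelations.\<close>
    define X where "X = {i} \<times> (- {j})"
    define Y where "Y = (- {i}) \<times> {j}"
    have "V \<subseteq> U" "(c, I, J) \<notin> V"
      using cS unfolding V_def by auto
    then have "V \<subset> U" and VT: "V \<subseteq> T"
      using S "1.prems" by blast+
    then have "acyclic (forced V)"
      using "1.IH" by blast
    have avoid: "p \<noteq> c \<and> q \<noteq> c" if "(p, q) \<in> forced V" for p q
      using forced_cells[OF data_set_subset[OF T(1) VT] that] unfolding V_def by blast
    have no_path: "(y, x) \<notin> (forced V)\<^sup>*" if "x \<in> X" "y \<in> Y" for x y
    proof
      assume "(y, x) \<in> (forced V)\<^sup>*"
      moreover have "y \<noteq> x"
        using that unfolding X_def Y_def by auto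
      ultimately have path: "(y, x) \<in> (forced V)\<^sup>+"
        by (simp add: rtrancl_eq_or_trancl)
      obtain c' I' J' where S': "(c', I', J') \<in> V" "y \<in> I' \<times> J'" "x \<in> I' \<times> J'"
        using trancl_forced_common_subgame[OF T VT path] by (elim exE conjE)
      \<comment> \<open>Here \<open>x\<close> supplies the row \<open>i\<close> and \<open>y\<close>
        the column \<open>j\<close> of \<open>c\<close>.\<close>
      have "c \<in> I' \<times> J'"
        using S'(2,3) that by (auto simp: X_def Y_def c)
      then show False
        using S'(1) by (simp add: V_def)
    qed
    have not_mem: "c \<notin> X" "c \<notin> Y"
      by (simp_all add: X_def Y_def c)
    have "acyclic (forced V \<union> X \<times> {c} \<union> {c} \<times> Y)"
      by (rule acyclic_add_vertex[OF \<open>acyclic (forced V)\<close> avoid not_mem no_path])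
    moreover have "forced U \<subseteq> forced V \<union> X \<times> {c} \<union> {c} \<times> Y"
    proof (rule subrelI)
      fix p q
      assume "(p, q) \<in> forced U"
      then obtain k l K L where o: "((k, l), K, L) \<in> U" and
        pq: "p = (k, l) \<and> (\<exists>k'\<in>K - {k}. q = (k', l)) \<or> q = (k, l) \<and> (\<exists>l'\<in>L - {l}. p = (k, l'))"
        unfolding forced_def by blast
      show "(p, q) \<in> forced V \<union> X \<times> {c} \<union> {c} \<times> Y"
      proof (cases "c \<in> K \<times> L")
        case True
        with o have "(k, l) = c" by (rule center)
        then show ?thesis using pq by (auto simp: X_def Y_def c)
      next
        case False
        then have "((k, l), K, L) \<in> V" using o by (simp add: V_def)
        then show ?thesis using pq unfolding forced_def by blast
      qed
    qed
    ultimately show ?thesis by (rule acyclic_subset)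
  qed
qed

text \<open>The potential counts proper descendants. Along an edge from \<open>p\<close> to
  \<open>q\<close>, those of \<open>q\<close> are also those of \<open>p\<close>, while
  \<open>q\<close> itself descends from \<open>p\<close> but, by acyclicity, not from
  \<open>q\<close>.\<close>

lemma acyclic_potential:
  fixes R :: "'a::finite rel"
  assumes "acyclic R"
  obtains f :: "'a \<Rightarrow> nat" where "\<And>p q. (p, q) \<in> R \<Longrightarrow> f q < f p"
proof
  fix p q
  assume pq: "(p, q) \<in> R"
  have "q \<notin> R\<^sup>+ `` {q}"
    using assms by (simp add: acyclic_def)
  then have "R\<^sup>+ `` {q} \<subset> R\<^sup>+ `` {p}"
    using pq by (auto intro: trancl_into_trancl2)
  then show "card (R\<^sup>+ `` {q}) < card (R\<^sup>+ `` {p})"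
    by (simp add: psubset_card_mono)
qed

theorem theorem3:
  fixes T :: "'n::finite observation set"
  assumes "data_set T"
    and "laminar T"
    and "uniqueness_property T"
  shows "\<exists>A :: real^'n^'n. rationalizes A (- A) T"
proof -
  have "acyclic (forced T)"
  proof (rule acyclic_forced[OF assms(1,2) _ subset_refl])
    fix c c' :: "'n \<times> 'n" and I J I' J'
    assume "(c, I, J) \<in> T" "(c', I', J') \<in> T" "I' \<times> J' \<subseteq> I \<times> J" "c \<in> I' \<times> J'"
    moreover obtain i j i' j' where "c = (i, j)" "c' = (i', j')"
      by fastforce
    ultimately show "c' = c"
      using assms(3) unfolding uniqueness_property_def by blast
  qed
  then obtain f :: "'n \<times> 'n \<Rightarrow> nat" where f: "\<And>p q. (p, q) \<in> forced T \<Longrightarrow> f q < f p"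
    using acyclic_potential by blast
  define A :: "real^'n^'n" where "A = (\<chi> i j. real (f (i, j)))"
  have "strict_nash A (- A) I J i j" if o: "((i, j), I, J) \<in> T" for i j I J
  proof -
    have "((i, j), (i', j)) \<in> forced T" if "i' \<in> I - {i}" for i'
      using o that unfolding forced_def by blast
    moreover have "((i, j'), (i, j)) \<in> forced T" if "j' \<in> J - {j}" for j'
      using o that unfolding forced_def by blast
    ultimately show ?thesis
      using f o assms(1) unfolding strict_nash_def data_set_def A_def by simp
  qed
  then show ?thesis
    unfolding rationalizes_def by blast
qed

end
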